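(* Let $L:\mathbb{R}^{2n}\to\mathbb{R}$, $L=L(q^1,\ldots,q^n,\dot q^1,\ldots,\dot q^n)$, be a regular Lagrangian for a system with $n$ degrees of freedom $(q^1,\ldots,q^n)$ with a quasi-cyclic coordinate $q^1$, i.e. there is a function $f(q^1,\ldots,q^n)$ such that $\frac{\partial L}{\partial q^1}=\sum_{i=1}^n\dot q^i\frac{\partial f}{\partial q^i}$. Then $L$ is Routh-reducible, in the sense of (a)-(c) below, if (i) $\frac{\partial^2L}{\partial\dot q^1\partial\dot q^1}\neq 0$, and (ii) there exist $n-1$ functions $\Gamma_k$, independent of $q^1$, such that $\frac{\partial f}{\partial q^k}=\Gamma_k(q^2,\ldots,q^n)\,\frac{\partial f}{\partial q^1}$ for $k=2,\ldots,n$. For $\mu$ a constant, consider the Routhian $$R^\mu=L-(\mu+f(q))\Big(\dot q^1+\sum_{k=2}^n\Gamma_k\dot q^k\Big),$$ where all instances of $\dot q^1$ are replaced by the expression for $\dot q^1$ in terms of the remaining variables obtained from the equation $\frac{\partial L}{\partial\dot q^1}=\mu+f$. Then: (a) $R^\mu$ is independent of $q^1$ and can be seen as a Lagrangian $R^\mu:\mathbb{R}^{2(n-1)}\to\mathbb{R}$ for a system with $n-1$ degrees of freedom $(q^2,\ldots,q^n)$. (b) Any solution $(q^1(t),\ldots,q^n(t))$ of the Euler-Lagrange equations $\frac{d}{dt}\left(\frac{\partial L}{\partial\dot q^i}\right)-\frac{\partial L}{\partial q^i}=0$, $i=1,\ldots,n$, such that $\frac{\partial L}{\partial\dot q^1}-f=\mu$,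 projects onto a solution $(q^2(t),\ldots,q^n(t))$ of the Euler-Lagrange equations $\frac{d}{dt}\left(\frac{\partial R^\mu}{\partial\dot q^k}\right)-\frac{\partial R^\mu}{\partial q^k}=0$, $k=2,\ldots,n$. (c) Conversely, any solution of the Euler-Lagrange equations for $R^\mu$ can be lifted to a solution of the Euler-Lagrange equations for $L$ for which $\frac{\partial L}{\partial\dot q^1}-f=\mu$.
   Context: The Lagrangian $L$ is regular if its Legendre transformation (fibre derivative) $(q,\dot q)\mapsto(q,\partial L/\partial\dot q)$ is a diffeomorphism. If $q^1$ is quasi-cyclic with function $f$, then $\partial L/\partial\dot q^1-f$ is a first integral of the Euler-Lagrange equations for $L$. When $\partial^2L/\partial\dot q^1\partial\dot q^1\neq0$, it is understood that the equation $\partial L/\partial\dot q^1-f=\mu$ can be solved for $\dot q^1$ in terms of the remaining variables, and this is the expression substituted in the definition of $R^\mu$. Euler-Lagrange equations are evaluated along curves $q(t)$ with $\dot q=dq/dt$.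
   Formalization: If f is constant, condition (ii) leaves the Γ_k arbitrary and the claim can fail (n=3, L=|q̇|²/2, f=0, μ=1, Γ_2=0, Γ_3=q^2); in that case ∂Γ_k/∂q^l=∂Γ_l/∂q^k is assumed in addition. *)

theory Defs
  imports "HOL-Analysis.Analysis"
begin

section \<open>Smooth maps and diffeomorphisms\<close>

primrec cont_diff :: "nat \<Rightarrow> ('a::euclidean_space \<Rightarrow> 'b::euclidean_space) \<Rightarrow> bool" where
  "cont_diff 0 g \<longleftrightarrow> continuous_on UNIV g"
| "cont_diff (Suc k) g \<longleftrightarrow>
     (\<forall>x. g differentiable (at x)) \<and> (\<forall>h. cont_diff k (\<lambda>x. frechet_derivative g (at x) h))"

definition smooth :: "('a::euclidean_space \<Rightarrow> 'b::euclidean_space) \<Rightarrow> bool" where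
  "smooth g \<longleftrightarrow> (\<forall>k. cont_diff k g)"

definition diffeomorphism :: "('a::euclidean_space \<Rightarrow> 'b::euclidean_space) \<Rightarrow> bool" where
  "diffeomorphism g \<longleftrightarrow> bij g \<and> smooth g \<and> smooth (inv g)"

section \<open>Lagrangian systems\<close>

text \<open>
  A Lagrangian is a function of pairs (position, velocity). Its partial derivatives are the
  ordinary one-variable derivatives along the coordinate axes.
\<close>

definition dir_deriv :: "('a::real_normed_vector \<Rightarrow> real) \<Rightarrow> 'a \<Rightarrow> 'a \<Rightarrow> real" where
  "dir_deriv g d z = deriv (\<lambda>s. g (z + s *\<^sub>R d)) 0"

definition partial :: "'n::finite \<Rightarrow> (real^'n \<Rightarrow> real) \<Rightarrow> real^'n \<Rightarrow> real" where
  "partial i g = dir_deriv g (axis i 1)"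

definition partial_pos ::
    "'n::finite \<Rightarrow> ((real^'n) \<times> (real^'n) \<Rightarrow> real) \<Rightarrow> (real^'n) \<times> (real^'n) \<Rightarrow> real" where
  "partial_pos i L = dir_deriv L (axis i 1, 0)"

definition partial_vel ::
    "'n::finite \<Rightarrow> ((real^'n) \<times> (real^'n) \<Rightarrow> real) \<Rightarrow> (real^'n) \<times> (real^'n) \<Rightarrow> real" where
  "partial_vel i L = dir_deriv L (0, axis i 1)"

definition legendre ::
    "((real^'n::finite) \<times> (real^'n) \<Rightarrow> real) \<Rightarrow> (real^'n) \<times> (real^'n) \<Rightarrow> (real^'n) \<times> (real^'n)" where
  "legendre L z = (fst z, \<chi> i. partial_vel i L z)"

definition regular_lagrangian :: "((real^'n::finite) \<times> (real^'n) \<Rightarrow> real) \<Rightarrow> bool" where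
  "regular_lagrangian L \<longleftrightarrow> diffeomorphism (legendre L)"

abbreviation velocity :: "(real \<Rightarrow> real^'n::finite) \<Rightarrow> real \<Rightarrow> real^'n" where
  "velocity q t \<equiv> vector_derivative q (at t)"

text \<open>
  Solutions are curves of class \<open>C\<^sup>2\<close> on a time interval \<open>I\<close>, which is meant to be
  open; only the values of \<open>q\<close> on \<open>I\<close> are relevant.
\<close>

definition EL_solution ::
    "((real^'n::finite) \<times> (real^'n) \<Rightarrow> real) \<Rightarrow> real set \<Rightarrow> (real \<Rightarrow> real^'n) \<Rightarrow> bool" where
  "EL_solution L I q \<longleftrightarrow>
     q C1_differentiable_on I \<and> velocity q C1_differentiable_on I \<and>
     (\<forall>i. \<forall>t\<in>I. ((\<lambda>t. partial_vel i L (q t, velocity q t))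
        has_real_derivative partial_pos i L (q t, velocity q t)) (at t))"

definition quasi_cyclic ::
    "'n::finite \<Rightarrow> ((real^'n) \<times> (real^'n) \<Rightarrow> real) \<Rightarrow> (real^'n \<Rightarrow> real) \<Rightarrow> bool" where
  "quasi_cyclic c L f \<longleftrightarrow>
     (\<forall>q v. partial_pos c L (q, v) = (\<Sum>i\<in>UNIV. v $ i * partial i f q))"

section \<open>Routh reduction\<close>

text \<open>
  The \<open>n\<close> coordinates are indexed by \<open>'m option\<close>, so that \<open>n - 1 = CARD('m)\<close>:
  the index \<open>None\<close> is that of the quasi-cyclic coordinate and the indices \<open>Some k\<close>
  are those of the remaining ones.
\<close>

definition rest :: "real^('m::finite option) \<Rightarrow> real^'m" where
  "rest q = (\<chi> k. q $ Some k)"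

definition join :: "real \<Rightarrow> real^'m::finite \<Rightarrow> real^('m option)" where
  "join u x = (\<chi> i. case i of None \<Rightarrow> u | Some k \<Rightarrow> x $ k)"

text \<open>
  The velocity of the quasi-cyclic coordinate as determined by the momentum equation
  \<open>\<partial>L/\<partial>v\<^sub>1 = \<mu> + f\<close>, at position \<open>q\<close> and remaining velocities \<open>w\<close>.
\<close>

definition cyclic_velocity ::
    "((real^('m::finite option)) \<times> (real^('m option)) \<Rightarrow> real) \<Rightarrow> (real^('m option) \<Rightarrow> real) \<Rightarrow> real
     \<Rightarrow> real^('m option) \<Rightarrow> real^'m \<Rightarrow> real" where
  "cyclic_velocity L f \<mu> q w = (THE u. partial_vel None L (q, join u w) = \<mu> + f q)"

definition routhian ::
    "((real^('m::finite option)) \<times> (real^('m option)) \<Rightarrow> real) \<Rightarrow> (real^('m option) \<Rightarrow> real)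
     \<Rightarrow> ('m \<Rightarrow> real^'m \<Rightarrow> real) \<Rightarrow> real \<Rightarrow> real^('m option) \<Rightarrow> real^'m \<Rightarrow> real" where
  "routhian L f \<Gamma> \<mu> q w =
     (let u = cyclic_velocity L f \<mu> q w
      in L (q, join u w) - (\<mu> + f q) * (u + (\<Sum>k\<in>UNIV. \<Gamma> k (rest q) * w $ k)))"

text \<open>
  The one-form with coefficients \<open>\<Gamma> k\<close> is closed. The relation
  \<open>\<partial>f/\<partial>q\<^sub>k = \<Gamma>\<^sub>k \<cdot> \<partial>f/\<partial>q\<^sub>1\<close> forces this unless \<open>f\<close> is constant. For constant \<open>f\<close> that
  relation is void, and the Routhian would acquire a spurious gyroscopic term
  if \<open>\<Gamma>\<close> were not closed.
\<close>

definition closed_form :: "('m::finite \<Rightarrow> real^'m \<Rightarrow> real) \<Rightarrow> bool" where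
  "closed_form \<Gamma> \<longleftrightarrow> (\<forall>k l x. partial l (\<Gamma> k) x = partial k (\<Gamma> l) x)"

end

theory Submission
  imports Defs
begin

text \<open>
  Write \<open>\<theta>(q, v) = v\<^sub>1 + \<Sum>\<^sub>k \<Gamma>\<^sub>k v\<^sub>k\<close> and \<open>M = L - (\<mu> + f) \<theta>\<close>. Condition (ii) says \<open>df = (\<partial>f/\<partial>q\<^sub>1) \<theta>\<close>, so
  quasi-cyclicity makes \<open>q\<^sub>1\<close> a genuinely cyclic coordinate of \<open>M\<close>, and the momentum equation becomes
  \<open>\<partial>M/\<partial>v\<^sub>1 = 0\<close>. Its solution \<open>v\<^sub>1 = U\<close> is therefore independent of \<open>q\<^sub>1\<close> and smooth by the implicit
  function theorem, the Routhian is \<open>M\<close> with \<open>v\<^sub>1\<close> eliminated, and its derivatives are those of \<open>M\<close>.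
  Closedness of \<open>\<Gamma>\<close> says that along any curve \<open>(\<mu> + f) \<theta>\<close> contributes nothing to the
  Euler-Lagrange equations of the remaining coordinates, so those of \<open>L\<close> and of the Routhian agree.
  Since \<open>U\<close> does not involve \<open>q\<^sub>1\<close>, a reduced solution is lifted by a mere quadrature.

  Where \<open>\<partial>f/\<partial>q\<^sub>1\<close> is nonzero for some \<open>q\<^sub>1\<close>, closedness of \<open>\<Gamma>\<close> is the symmetry of the second derivatives of \<open>f\<close>.
  If \<open>\<partial>f/\<partial>q\<^sub>1\<close> vanishes on a whole \<open>q\<^sub>1\<close>-line, then \<open>f\<close> is constant, since any point can be joined to that line
  by a curve tangent to the kernel of \<open>\<theta>\<close>.
\<close>

section \<open>Smooth functions and directional derivatives\<close>

lemma frechet_derivative_eqI: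
  assumes "(g has_derivative g') (at x)"
  shows "frechet_derivative g (at x) = g'"
  using frechet_derivative_at[OF assms] by simp

lemma cont_diff_has_derivative:
  "cont_diff (Suc k) g \<Longrightarrow> (g has_derivative frechet_derivative g (at x)) (at x)"
  by (simp add: frechet_derivative_works)

text \<open>Lets any explicit formula for the derivative stand in for
  \<open>frechet_derivative\<close>, so that each closure property below is an induction on the
  order, read off from the matching differentiation rule.\<close>

lemma cont_diff_SucI:
  assumes "\<And>x. (g has_derivative g' x) (at x)"
    and "\<And>h. cont_diff k (\<lambda>x. g' x h)"
  shows "cont_diff (Suc k) g"
proof -
  have "frechet_derivative g (at x) = g' x" for x
    using frechet_derivative_eqI[OF assms(1)] .
  then show ?thesis
    using assms by (auto simp: differentiable_def)
qed

text \<open>The product, inverse and chain rules leave some factors undifferentiated, and the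
  induction needs those factors at one order lower.\<close>

lemma cont_diff_Suc_imp: "cont_diff (Suc k) g \<Longrightarrow> cont_diff k g"
proof (induction k arbitrary: g)
  case 0
  then show ?case
    by (simp add: continuous_at_imp_continuous_on differentiable_imp_continuous_within)
next
  case (Suc k)
  from Suc.prems have "cont_diff k (\<lambda>x. frechet_derivative g (at x) h)" for h
    by (intro Suc.IH) (subst (asm) cont_diff.simps(2), blast)
  with Suc.prems show ?case by simp
qed

lemma cont_diff_const: "cont_diff k (\<lambda>x. c)"
proof (induction k arbitrary: c)
  case (Suc k)
  show ?case
    by (rule cont_diff_SucI[where g' = "\<lambda>x h. 0"]) (auto simp: Suc.IH)
qed simp

lemma cont_diff_linear: "bounded_linear g \<Longrightarrow> cont_diff k g"
proof (cases k)
  case 0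
  assume "bounded_linear g"
  then show ?thesis using 0 by (simp add: linear_continuous_on)
next
  case (Suc j)
  assume "bounded_linear g"
  then show ?thesis unfolding Suc
    by (intro cont_diff_SucI[where g' = "\<lambda>x. g"])
      (auto simp: bounded_linear_imp_has_derivative cont_diff_const)
qed

lemma cont_diff_linear_compose:
  assumes A: "bounded_linear A" and "cont_diff k g"
  shows "cont_diff k (\<lambda>x. A (g x))"
  using assms(2)
proof (induction k arbitrary: g)
  case 0
  then show ?case
    using bounded_linear.continuous_on[OF A] by auto
next
  case (Suc k)
  show ?case
  proof (rule cont_diff_SucI)
    show "((\<lambda>x. A (g x)) has_derivative (\<lambda>h. A (frechet_derivative g (at x) h))) (at x)" for x
      by (rule bounded_linear.has_derivative[OF A cont_diff_has_derivative[OF Suc.prems]])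
    show "cont_diff k (\<lambda>x. A (frechet_derivative g (at x) h))" for h
      using Suc.prems by (intro Suc.IH) simp_all
  qed
qed

lemma cont_diff_add:
  assumes "cont_diff k g" "cont_diff k h"
  shows "cont_diff k (\<lambda>x. g x + h x)"
  using assms
proof (induction k arbitrary: g h)
  case 0
  then show ?case by (simp add: continuous_on_add)
next
  case (Suc k)
  show ?case
  proof (rule cont_diff_SucI)
    show "((\<lambda>x. g x + h x) has_derivative
        (\<lambda>d. frechet_derivative g (at x) d + frechet_derivative h (at x) d)) (at x)" for x
      by (intro has_derivative_add Suc.prems[THEN cont_diff_has_derivative])
    show "cont_diff k (\<lambda>x. frechet_derivative g (at x) d + frechet_derivative h (at x) d)" for d
      using Suc.prems by (intro Suc.IH) simp_all
  qed
qed

lemma cont_diff_Pair: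
  assumes "cont_diff k g" "cont_diff k h"
  shows "cont_diff k (\<lambda>x. (g x, h x))"
proof -
  have "cont_diff k (\<lambda>x. (g x, 0) + (0, h x))"
    by (intro cont_diff_add cont_diff_linear_compose[where A = "\<lambda>y. (y, 0)"]
        cont_diff_linear_compose[where A = "\<lambda>y. (0, y)"] assms
        bounded_linear_Pair bounded_linear_ident bounded_linear_zero)
  then show ?thesis by simp
qed

lemma cont_diff_scaleR:
  assumes "cont_diff k g" "cont_diff k h"
  shows "cont_diff k (\<lambda>x. g x *\<^sub>R h x)"
  using assms
proof (induction k arbitrary: g h)
  case 0
  then show ?case by (simp add: continuous_on_scaleR)
next
  case (Suc k)
  show ?case
  proof (rule cont_diff_SucI)
    show "((\<lambda>x. g x *\<^sub>R h x) has_derivative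
        (\<lambda>d. g x *\<^sub>R frechet_derivative h (at x) d + frechet_derivative g (at x) d *\<^sub>R h x)) (at x)" for x
      by (intro has_derivative_scaleR Suc.prems[THEN cont_diff_has_derivative])
    show "cont_diff k (\<lambda>x. g x *\<^sub>R frechet_derivative h (at x) d
        + frechet_derivative g (at x) d *\<^sub>R h x)" for d
      using Suc.prems Suc.prems[THEN cont_diff_Suc_imp] by (intro cont_diff_add Suc.IH) simp_all
  qed
qed

lemma cont_diff_mult:
  fixes g h :: "'a::euclidean_space \<Rightarrow> real"
  shows "cont_diff k g \<Longrightarrow> cont_diff k h \<Longrightarrow> cont_diff k (\<lambda>x. g x * h x)"
  using cont_diff_scaleR[of k g h] by simp

lemma cont_diff_sum:
  "(\<And>i. i \<in> A \<Longrightarrow> cont_diff k (g i)) \<Longrightarrow> cont_diff k (\<lambda>x. \<Sum>i\<in>A. g i x)"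
  by (induction A rule: infinite_finite_induct) (auto intro: cont_diff_const cont_diff_add)

lemma cont_diff_inverse:
  fixes g :: "'a::euclidean_space \<Rightarrow> real"
  assumes "cont_diff k g" and nz: "\<And>x. g x \<noteq> 0"
  shows "cont_diff k (\<lambda>x. inverse (g x))"
  using assms(1)
proof (induction k)
  case 0
  then show ?case using nz by (simp add: continuous_on_inverse)
next
  case (Suc k)
  show ?case
  proof (rule cont_diff_SucI)
    show "((\<lambda>x. inverse (g x)) has_derivative
        (\<lambda>d. - (inverse (g x) * frechet_derivative g (at x) d * inverse (g x)))) (at x)" for x
      using Deriv.has_derivative_inverse[OF nz cont_diff_has_derivative[OF Suc.prems]] .
    show "cont_diff k (\<lambda>x. - (inverse (g x) * frechet_derivative g (at x) d * inverse (g x)))" for d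
      using Suc.prems Suc.IH cont_diff_Suc_imp[OF Suc.prems]
      by (intro cont_diff_linear_compose[where A = uminus] cont_diff_mult
          bounded_linear_minus bounded_linear_ident) auto
  qed
qed

text \<open>\<open>cont_diff\<close> controls the derivative only in a fixed direction. In the chain
  rule the direction varies with the point; this expansion turns it into scalar coefficients against
  fixed directions.\<close>

lemma linear_sum_Basis:
  fixes A :: "'a::euclidean_space \<Rightarrow> 'b::real_vector"
  assumes "linear A"
  shows "A h = (\<Sum>b\<in>Basis. (h \<bullet> b) *\<^sub>R A b)"
proof -
  have "A h = A (\<Sum>b\<in>Basis. (h \<bullet> b) *\<^sub>R b)" by (simp add: euclidean_representation)
  then show ?thesis by (simp add: linear_sum[OF assms] linear_scale[OF assms])
qed

lemma cont_diff_compose: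
  assumes "cont_diff k g" "cont_diff k h"
  shows "cont_diff k (\<lambda>x. g (h x))"
  using assms
proof (induction k arbitrary: g h)
  case 0
  then show ?case by (auto intro: continuous_on_compose2[of UNIV g])
next
  case (Suc k)
  show ?case
  proof (rule cont_diff_SucI)
    have lin: "linear (frechet_derivative g (at y))" for y
      using cont_diff_has_derivative[OF Suc.prems(1)] has_derivative_linear by blast
    show "((\<lambda>x. g (h x)) has_derivative
        (\<lambda>d. \<Sum>b\<in>Basis. (frechet_derivative h (at x) d \<bullet> b) *\<^sub>R frechet_derivative g (at (h x)) b)) (at x)" for x
      using has_derivative_compose[OF cont_diff_has_derivative[OF Suc.prems(2)]
          cont_diff_has_derivative[OF Suc.prems(1)]]
      by (subst (asm) linear_sum_Basis[OF lin])
    show "cont_diff k (\<lambda>x. \<Sum>b\<in>Basis. (frechet_derivative h (at x) d \<bullet> b) *\<^sub>R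
        frechet_derivative g (at (h x)) b)" for d
      using Suc.prems cont_diff_Suc_imp[OF Suc.prems(2)]
      by (intro cont_diff_sum cont_diff_scaleR cont_diff_linear_compose[where A = "\<lambda>y. y \<bullet> _"]
          bounded_linear_inner_left Suc.IH) auto
  qed
qed

lemma smooth_const: "smooth (\<lambda>x. c)"
  and smooth_linear: "bounded_linear g \<Longrightarrow> smooth g"
  and smooth_add: "smooth g \<Longrightarrow> smooth h \<Longrightarrow> smooth (\<lambda>x. g x + h x)"
  and smooth_Pair: "smooth g \<Longrightarrow> smooth k \<Longrightarrow> smooth (\<lambda>x. (g x, k x))"
  and smooth_compose: "smooth l \<Longrightarrow> smooth g \<Longrightarrow> smooth (\<lambda>x. l (g x))"
  and smooth_sum: "(\<And>i. i \<in> A \<Longrightarrow> smooth (s i)) \<Longrightarrow> smooth (\<lambda>x. \<Sum>i\<in>A. s i x)"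
  by (auto simp: smooth_def intro: cont_diff_const cont_diff_linear cont_diff_add cont_diff_Pair
      cont_diff_compose cont_diff_sum)

lemma smooth_mult:
  fixes g h :: "'a::euclidean_space \<Rightarrow> real"
  shows "smooth g \<Longrightarrow> smooth h \<Longrightarrow> smooth (\<lambda>x. g x * h x)"
  by (auto simp: smooth_def intro: cont_diff_mult)

lemma smooth_diff:
  fixes g h :: "'a::euclidean_space \<Rightarrow> 'b::euclidean_space"
  assumes "smooth g" "smooth h"
  shows "smooth (\<lambda>x. g x - h x)"
  using smooth_add[OF assms(1) smooth_compose[OF smooth_linear[of uminus] assms(2)]]
  by (simp add: bounded_linear_minus bounded_linear_ident)

lemma smooth_has_derivative:
  "smooth g \<Longrightarrow> (g has_derivative frechet_derivative g (at x)) (at x)"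
  unfolding smooth_def using cont_diff_has_derivative by blast

lemma smooth_frechet_derivative: "smooth g \<Longrightarrow> smooth (\<lambda>x. frechet_derivative g (at x) h)"
  unfolding smooth_def using cont_diff.simps(2) by blast

lemma smooth_continuous_on: "smooth g \<Longrightarrow> continuous_on S g"
  unfolding smooth_def using cont_diff.simps(1) continuous_on_subset by blast

section \<open>Directional derivatives and their symmetry\<close>

lemma has_derivative_along_line:
  fixes g :: "'a::real_normed_vector \<Rightarrow> real"
  assumes "(g has_derivative g') (at (z + s *\<^sub>R d))"
  shows "((\<lambda>s. g (z + s *\<^sub>R d)) has_real_derivative g' d) (at s)"
proof -
  interpret g': bounded_linear g' using assms by (rule has_derivative_bounded_linear)
  have "((\<lambda>s. z + s *\<^sub>R d) has_derivative (\<lambda>h. h *\<^sub>R d)) (at s)"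
    by (auto intro!: derivative_eq_intros)
  from has_derivative_compose[OF this assms] show ?thesis
    by (simp add: has_field_derivative_def g'.scaleR mult.commute[of _ "g' d"])
qed

lemma dir_deriv_eqI:
  assumes "(g has_derivative g') (at z)"
  shows "dir_deriv g d z = g' d"
  using has_derivative_along_line[of g g' z 0 d] assms
  by (simp add: dir_deriv_def DERIV_imp_deriv)

lemma dir_deriv_eq_frechet:
  "smooth g \<Longrightarrow> dir_deriv g d z = frechet_derivative g (at z) d"
  by (rule dir_deriv_eqI[OF smooth_has_derivative])

lemma smooth_dir_deriv: 
  assumes "smooth g" shows "smooth (dir_deriv g d)"
  using smooth_frechet_derivative[OF assms] by (simp add: dir_deriv_eq_frechet[OF assms, abs_def])

lemma smooth_has_derivative_dir_deriv:
  "smooth g \<Longrightarrow> (g has_derivative (\<lambda>d. dir_deriv g d z)) (at z)"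
  using smooth_has_derivative[of g z] by (simp add: dir_deriv_eq_frechet)

lemma dir_deriv_zero [simp]: "dir_deriv g 0 z = 0"
  by (simp add: dir_deriv_def)

lemma linear_dir_deriv:
  "smooth g \<Longrightarrow> linear (\<lambda>d. dir_deriv g d z)"
  by (rule has_derivative_linear[OF smooth_has_derivative_dir_deriv])

lemma DERIV_smooth_along_line:
  "smooth g \<Longrightarrow> ((\<lambda>s. g (z + s *\<^sub>R d)) has_real_derivative dir_deriv g d (z + s *\<^sub>R d)) (at s)"
  by (rule has_derivative_along_line[OF smooth_has_derivative_dir_deriv])

text \<open>The mean value theorem is applied twice: along \<open>d\<close> to the difference of
  \<open>g\<close> on two opposite sides of the parallelogram, then along \<open>e\<close> to
  \<open>dir_deriv g d\<close>.\<close>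

lemma second_difference_mvt:
  fixes g :: "'a::euclidean_space \<Rightarrow> real"
  assumes "smooth g" and "0 < s"
  obtains a b where "0 < a" "a < s" "0 < b" "b < s"
    and "g (z + s *\<^sub>R d + s *\<^sub>R e) - g (z + s *\<^sub>R d) - g (z + s *\<^sub>R e) + g z
      = s * s * dir_deriv (dir_deriv g d) e (z + a *\<^sub>R d + b *\<^sub>R e)"
proof -
  define \<alpha> where "\<alpha> r = g ((z + s *\<^sub>R e) + r *\<^sub>R d) - g (z + r *\<^sub>R d)" for r
  have "(\<alpha> has_real_derivative
      dir_deriv g d ((z + s *\<^sub>R e) + r *\<^sub>R d) - dir_deriv g d (z + r *\<^sub>R d)) (at r)" for r
    unfolding \<alpha>_def by (intro DERIV_diff DERIV_smooth_along_line assms)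
  from MVT2[OF \<open>0 < s\<close> this] obtain a where a: "0 < a" "a < s" and
    1: "\<alpha> s - \<alpha> 0 = s * (dir_deriv g d ((z + s *\<^sub>R e) + a *\<^sub>R d) - dir_deriv g d (z + a *\<^sub>R d))"
    by auto
  have "((\<lambda>r. dir_deriv g d ((z + a *\<^sub>R d) + r *\<^sub>R e)) has_real_derivative
      dir_deriv (dir_deriv g d) e ((z + a *\<^sub>R d) + r *\<^sub>R e)) (at r)" for r
    by (intro DERIV_smooth_along_line smooth_dir_deriv assms)
  from MVT2[OF \<open>0 < s\<close> this] obtain b where b: "0 < b" "b < s" and
    2: "dir_deriv g d ((z + a *\<^sub>R d) + s *\<^sub>R e) - dir_deriv g d (z + a *\<^sub>R d)
      = s * dir_deriv (dir_deriv g d) e ((z + a *\<^sub>R d) + b *\<^sub>R e)"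
    by auto
  show thesis
    using a b 1 2 by (intro that[of a b]) (simp_all add: \<alpha>_def algebra_simps)
qed

text \<open>The second difference is symmetric in \<open>d\<close> and \<open>e\<close>, so each
  mixed derivative takes, somewhere in an arbitrarily small parallelogram at \<open>z\<close>, a
  value that the other one takes there too. Continuity carries the equality to
  \<open>z\<close>.\<close>

lemma dir_deriv_commute:
  fixes g :: "'a::euclidean_space \<Rightarrow> real"
  assumes g: "smooth g"
  shows "dir_deriv (dir_deriv g d) e z = dir_deriv (dir_deriv g e) d z"
proof -
  define A where "A = dir_deriv (dir_deriv g d) e"
  define B where "B = dir_deriv (dir_deriv g e) d"
  have "\<bar>A z - B z\<bar> \<le> \<epsilon>" if "\<epsilon> > 0" for \<epsilon>
  proof -
    have "isCont A z" "isCont B z"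
      using smooth_continuous_on[OF smooth_dir_deriv[OF smooth_dir_deriv[OF g]], of UNIV]
      by (auto simp: A_def B_def continuous_on_eq_continuous_at)
    then obtain r1 r2 where r: "r1 > 0" "r2 > 0"
      "\<And>y. dist y z < r1 \<Longrightarrow> \<bar>A y - A z\<bar> < \<epsilon> / 2"
      "\<And>y. dist y z < r2 \<Longrightarrow> \<bar>B y - B z\<bar> < \<epsilon> / 2"
      using half_gt_zero[OF \<open>\<epsilon> > 0\<close>] unfolding continuous_at_eps_delta dist_real_def by blast
    \<comment> \<open>Small enough to keep the whole parallelogram within both radii; the summand 1
      keeps the denominator positive when \<open>d\<close> and \<open>e\<close> vanish.\<close>
    define s where "s = min r1 r2 / (norm d + norm e + 1)"
    have pos: "norm d + norm e + 1 > 0" by (simp add: add_nonneg_pos)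
    have "s > 0" using r pos by (simp add: s_def)
    have near: "dist (z + a *\<^sub>R d + b *\<^sub>R e) z < min r1 r2"
      if "0 < a" "a < s" "0 < b" "b < s" for a b
    proof -
      have "dist (z + a *\<^sub>R d + b *\<^sub>R e) z \<le> norm (a *\<^sub>R d) + norm (b *\<^sub>R e)"
        by (metis add.assoc add_diff_cancel_left' dist_norm norm_triangle_ineq)
      also have "\<dots> \<le> s * norm d + s * norm e"
        using that by (auto intro!: add_mono mult_right_mono)
      also have "\<dots> < s * (norm d + norm e + 1)" using \<open>s > 0\<close> by (simp add: algebra_simps)
      also have "\<dots> = min r1 r2" using pos by (simp add: s_def)
      finally show ?thesis .
    qed
    obtain a b where ab: "0 < a" "a < s" "0 < b" "b < s"
      "g (z + s *\<^sub>R d + s *\<^sub>R e) - g (z + s *\<^sub>R d) - g (z + s *\<^sub>R e) + g z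
        = s * s * A (z + a *\<^sub>R d + b *\<^sub>R e)"
      using second_difference_mvt[OF g \<open>s > 0\<close>, of z d e] unfolding A_def by blast
    obtain a' b' where ab': "0 < a'" "a' < s" "0 < b'" "b' < s"
      "g (z + s *\<^sub>R e + s *\<^sub>R d) - g (z + s *\<^sub>R e) - g (z + s *\<^sub>R d) + g z
        = s * s * B (z + a' *\<^sub>R e + b' *\<^sub>R d)"
      using second_difference_mvt[OF g \<open>s > 0\<close>, of z e d] unfolding B_def by blast
    have "s * s * A (z + a *\<^sub>R d + b *\<^sub>R e) = s * s * B (z + b' *\<^sub>R d + a' *\<^sub>R e)"
      using ab(5) ab'(5) by (simp add: algebra_simps)
    then have "A (z + a *\<^sub>R d + b *\<^sub>R e) = B (z + b' *\<^sub>R d + a' *\<^sub>R e)" using \<open>s > 0\<close> by simp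
    moreover have "\<bar>A (z + a *\<^sub>R d + b *\<^sub>R e) - A z\<bar> < \<epsilon> / 2"
      "\<bar>B (z + b' *\<^sub>R d + a' *\<^sub>R e) - B z\<bar> < \<epsilon> / 2"
      using r(3,4) near[OF ab(1-4)] near[OF ab'(3,4,1,2)] by simp_all
    ultimately show ?thesis by linarith
  qed
  then have "\<bar>A z - B z\<bar> \<le> 0" by (rule field_le_epsilon) auto
  then show ?thesis by (simp add: A_def B_def)
qed

section \<open>A smooth implicit function theorem\<close>

lemma inj_in_fst:
  fixes P :: "real \<times> 'a::euclidean_space \<Rightarrow> real"
  assumes P: "smooth P" and nz: "\<And>z. dir_deriv P (1, 0) z \<noteq> 0"
    and eq: "P (u, y) = P (u', y)"
  shows "u = u'"
proof -
  have D: "((\<lambda>s. P (s, y)) has_real_derivative dir_deriv P (1, 0) (s, y)) (at s)" for s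
    using DERIV_smooth_along_line[OF P, of "(0, y)" "(1, 0)" s] by simp
  have "\<not> a < b" if "P (a, y) = P (b, y)" for a b
  proof
    assume "a < b"
    \<comment> \<open>Rolle's theorem: equal values at \<open>a\<close> and \<open>b\<close> would
      give a zero of the derivative in between. As the first variable runs over a full line,
      injectivity is global.\<close>
    from MVT2[OF this D] obtain s where "P (b, y) - P (a, y) = (b - a) * dir_deriv P (1, 0) (s, y)"
      by blast
    then show False using that \<open>a < b\<close> nz by simp
  qed
  from this[OF eq] this[OF eq[symmetric]] show ?thesis by simp
qed

text \<open>The map \<open>\<Phi> z = (P z, snd z)\<close> is globally injective, and
  \<open>U\<close> is the first component of its inverse over the value \<open>c\<close>. The
  inverse function theorem yields a first derivative; its formula involves only derivatives of
  \<open>P\<close> along the graph of \<open>U\<close>, so the order of \<open>U\<close> can be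
  raised step by step.\<close>

lemma implicit_function_smooth:
  fixes P :: "real \<times> 'a::euclidean_space \<Rightarrow> real" and U :: "'a \<Rightarrow> real"
  assumes P: "smooth P" and nz: "\<And>z. dir_deriv P (1, 0) z \<noteq> 0"
    and U: "\<And>y. P (U y, y) = c"
  shows "smooth U"
proof -
  define \<Phi> where "\<Phi> z = (P z, snd z)" for z
  have "inj \<Phi>"
    using inj_in_fst[OF P nz] by (auto simp: inj_def \<Phi>_def)
  have der: "(U has_derivative
      (\<lambda>h. - dir_deriv P (0, h) (U y, y) * inverse (dir_deriv P (1, 0) (U y, y)))) (at y)" for y
  proof -
    define z where "z = (U y, y)"
    define c' where "c' = dir_deriv P (1, 0) z"
    have "c' \<noteq> 0" by (simp add: c'_def nz)
    note lin = linear_dir_deriv[OF P, of z]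
    have split: "dir_deriv P (s, h) z = s * c' + dir_deriv P (0, h) z" for s h
    proof -
      have "(s, h) = s *\<^sub>R (1, 0) + (0, h)" by simp
      then show ?thesis
        unfolding c'_def using linear_add[OF lin, of "s *\<^sub>R (1, 0)" "(0, h)"] linear_scale[OF lin, of s "(1, 0)"]
        by simp
    qed
    have "(\<Phi> has_derivative (\<lambda>d. (dir_deriv P d z, snd d))) (at z)"
      unfolding \<Phi>_def
      by (intro has_derivative_Pair smooth_has_derivative_dir_deriv[OF P] has_derivative_snd has_derivative_ident)
    moreover have "continuous_on UNIV \<Phi>"
      unfolding \<Phi>_def by (intro continuous_intros smooth_continuous_on P)
    \<comment> \<open>The derivative of \<open>\<Phi>\<close> is triangular with nonzero entry
      \<open>c'\<close>; it is inverted by solving for the first component.\<close>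
    moreover have "(\<lambda>d. (dir_deriv P d z, snd d)) \<circ>
        (\<lambda>d. ((fst d - dir_deriv P (0, snd d) z) * inverse c', snd d)) = id"
      using \<open>c' \<noteq> 0\<close> by (simp add: fun_eq_iff split[of "_ * _"] mult.assoc)
    ultimately have "(inv \<Phi> has_derivative
        (\<lambda>d. ((fst d - dir_deriv P (0, snd d) z) * inverse c', snd d))) (at (\<Phi> z))"
      using inv_f_f[OF \<open>inj \<Phi>\<close>] has_derivative_inverse_strong[of UNIV z \<Phi> "inv \<Phi>"] by blast
    moreover have "\<Phi> z = (c, y)" by (simp add: \<Phi>_def z_def U)
    ultimately have inv': "(inv \<Phi> has_derivative
        (\<lambda>d. ((fst d - dir_deriv P (0, snd d) z) * inverse c', snd d))) (at (c, y))" by simp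
    have "((\<lambda>y. (c, y)) has_derivative (\<lambda>h. (0, h))) (at y)"
      by (auto intro!: derivative_eq_intros)
    from has_derivative_fst[OF has_derivative_compose[OF this inv']]
    have "((\<lambda>y. fst (inv \<Phi> (c, y))) has_derivative (\<lambda>h. - dir_deriv P (0, h) z * inverse c')) (at y)"
      by simp
    moreover have "inv \<Phi> (c, y) = (U y, y)" for y
      using \<open>inj \<Phi>\<close> by (intro inv_f_eq) (auto simp: \<Phi>_def U)
    ultimately show ?thesis by (simp add: z_def c'_def)
  qed
  have "cont_diff k U" for k
  proof (induction k)
    case 0
    then show ?case
      using has_derivative_continuous[OF der] by (auto intro: continuous_at_imp_continuous_on)
  next
    case (Suc k)
    have cd: "cont_diff k (\<lambda>y. dir_deriv P d (U y, y))" for d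
    proof (rule cont_diff_compose[of k "dir_deriv P d"])
      show "cont_diff k (dir_deriv P d)" using smooth_dir_deriv[OF P] by (simp add: smooth_def)
      show "cont_diff k (\<lambda>y. (U y, y))"
        by (rule cont_diff_Pair[OF Suc cont_diff_linear[OF bounded_linear_ident]])
    qed
    show ?case
      by (rule cont_diff_SucI[OF der], intro cont_diff_mult cont_diff_inverse nz cd
          cont_diff_linear_compose[where A = uminus] bounded_linear_minus bounded_linear_ident)
  qed
  then show ?thesis by (simp add: smooth_def)
qed

section \<open>Antiderivatives and curves\<close>

lemma antiderivative_on_open_interval:
  fixes g :: "real \<Rightarrow> real"
  assumes "open I" "is_interval I" "continuous_on I g"
  obtains F where "\<And>t. t \<in> I \<Longrightarrow> (F has_real_derivative g t) (at t)"
proof (cases "I = {}")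
  case False
  \<comment> \<open>Extended real end points treat bounded and unbounded intervals alike.\<close>
  define a where "a = Inf (ereal ` I)"
  define b where "b = Sup (ereal ` I)"
  have in_I: "t \<in> I" if "a < ereal t" "ereal t < b" for t
  proof -
    have "\<exists>l\<in>I. l < t" "\<exists>r\<in>I. t < r"
      using that by (auto simp: a_def b_def Inf_less_iff less_Sup_iff)
    then obtain l r where "l \<in> I" "r \<in> I" "l < t" "t < r" by blast
    then show ?thesis using \<open>is_interval I\<close> by (meson is_interval_1 less_imp_le)
  qed
  have of_I: "a < ereal t \<and> ereal t < b" if t: "t \<in> I" for t
  proof -
    \<comment> \<open>Openness leaves room on both sides of \<open>t\<close>, which makes the end
      points strict bounds.\<close>
    obtain e where "e > 0" "cball t e \<subseteq> I" using \<open>open I\<close> t open_contains_cball by blast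
    then have "t - e \<in> I" "t + e \<in> I" by (auto simp: cball_def dist_real_def subset_iff)
    then have "a \<le> ereal (t - e)" "ereal (t + e) \<le> b"
      unfolding a_def b_def by (auto intro: INF_lower SUP_upper)
    moreover have "ereal (t - e) < ereal t" "ereal t < ereal (t + e)" using \<open>e > 0\<close> by auto
    ultimately show ?thesis by (meson le_less_trans less_le_trans)
  qed
  have "a < b" using False of_I by (meson all_not_in_conv less_trans)
  moreover have "isCont g t" if "a < ereal t" "ereal t < b" for t
    using in_I[OF that] assms continuous_on_eq_continuous_at by blast
  ultimately obtain F where "\<forall>t. a < ereal t \<longrightarrow> ereal t < b \<longrightarrow> (F has_vector_derivative g t) (at t)"
    using einterval_antiderivative[of a b g] by blast
  then show thesis
    using of_I by (intro that[of F]) (simp add: has_real_derivative_iff_has_vector_derivative)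
qed simp

lemma smooth_along_curve:
  fixes g :: "'a::euclidean_space \<Rightarrow> real"
  assumes "smooth g" "(c has_vector_derivative v) (at t)"
  shows "((\<lambda>t. g (c t)) has_real_derivative dir_deriv g v (c t)) (at t)"
  using has_derivative_compose[OF assms(2)[unfolded has_vector_derivative_def]
      smooth_has_derivative_dir_deriv[OF assms(1)]] linear_scale[OF linear_dir_deriv[OF assms(1)]]
  by (simp add: has_field_derivative_def mult.commute[of _ "dir_deriv g v (c t)"])

lemma dir_deriv_linear_compose:
  assumes g: "smooth g" and A: "bounded_linear A"
  shows "dir_deriv (\<lambda>z. g (A z)) d z = dir_deriv g (A d) (A z)"
  by (rule dir_deriv_eqI[OF has_derivative_compose[OF bounded_linear_imp_has_derivative[OF A]
        smooth_has_derivative_dir_deriv[OF g]]])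

lemma C1_differentiable_on_smooth_compose:
  fixes g :: "'a::euclidean_space \<Rightarrow> 'b::euclidean_space"
  assumes g: "smooth g" and "c C1_differentiable_on I"
  shows "(\<lambda>t. g (c t)) C1_differentiable_on I"
proof -
  obtain D where D: "\<And>t. t \<in> I \<Longrightarrow> (c has_vector_derivative D t) (at t)" "continuous_on I D"
    using assms(2) unfolding C1_differentiable_on_def by blast
  have lin: "linear (frechet_derivative g (at y))" for y
    using smooth_has_derivative[OF g] has_derivative_linear by blast
  have "((\<lambda>t. g (c t)) has_vector_derivative frechet_derivative g (at (c t)) (D t)) (at t)"
    if "t \<in> I" for t
    using has_derivative_compose[OF D(1)[OF that, unfolded has_vector_derivative_def]
        smooth_has_derivative[OF g]]
    by (simp add: has_vector_derivative_def linear_scale[OF lin])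
  moreover have "continuous_on I c"
    using D(1) by (meson continuous_at_imp_continuous_on has_vector_derivative_continuous)
  \<comment> \<open>The velocity is again expanded in the basis, since the derivative of
    \<open>g\<close> is continuous in the point for each fixed direction.\<close>
  then have "continuous_on I (\<lambda>t. \<Sum>b\<in>Basis. (D t \<bullet> b) *\<^sub>R frechet_derivative g (at (c t)) b)"
    using D(2) smooth_continuous_on[OF smooth_frechet_derivative[OF g], of UNIV]
    by (intro continuous_on_sum continuous_on_scaleR continuous_on_inner continuous_on_const)
      (auto intro: continuous_on_compose2[of UNIV])
  then have "continuous_on I (\<lambda>t. frechet_derivative g (at (c t)) (D t))"
    by (subst linear_sum_Basis[OF lin])
  ultimately show ?thesis
    unfolding C1_differentiable_on_def
    by (intro exI[of _ "\<lambda>t. frechet_derivative g (at (c t)) (D t)"]) simp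
qed

text \<open>Derivatives at points of an open set see only values inside it. This serves to exchange
  a \<open>velocity\<close> for an expression that equals it on \<open>I\<close>.\<close>

lemma C1_differentiable_on_cong_open:
  assumes "open I" "\<And>t. t \<in> I \<Longrightarrow> c t = d t"
  shows "c C1_differentiable_on I \<longleftrightarrow> d C1_differentiable_on I"
proof -
  have "(c has_vector_derivative D) (at t) \<longleftrightarrow> (d has_vector_derivative D) (at t)" if "t \<in> I" for t D
    using has_vector_derivative_transform_within_open[OF _ assms(1) that, of c D d]
      has_vector_derivative_transform_within_open[OF _ assms(1) that, of d D c] assms(2)
    by auto
  then show ?thesis unfolding C1_differentiable_on_def by simp
qed

lemma C1_differentiable_on_has_velocity:
  "c C1_differentiable_on I \<Longrightarrow> t \<in> I \<Longrightarrow> (c has_vector_derivative vector_derivative c (at t)) (at t)"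
  by (simp add: C1_differentiable_on_eq flip: vector_derivative_works)

lemma C1_differentiable_on_Pair:
  assumes "c C1_differentiable_on I" "d C1_differentiable_on I"
  shows "(\<lambda>t. (c t, d t)) C1_differentiable_on I"
proof -
  obtain c' d' where
    "\<And>t. t \<in> I \<Longrightarrow> (c has_vector_derivative c' t) (at t)" "continuous_on I c'"
    "\<And>t. t \<in> I \<Longrightarrow> (d has_vector_derivative d' t) (at t)" "continuous_on I d'"
    using assms unfolding C1_differentiable_on_def by blast
  then show ?thesis
    unfolding C1_differentiable_on_def
    by (intro exI[of _ "\<lambda>t. (c' t, d' t)"]) (simp add: has_vector_derivative_Pair continuous_on_Pair)
qed

section \<open>Splitting off the quasi-cyclic coordinate\<close>

lemma join_nth [simp]: "join u x $ None = u" "join u x $ Some k = x $ k"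
  by (simp_all add: join_def)

lemma rest_nth [simp]: "rest q $ k = q $ Some k"
  by (simp add: rest_def)

lemma vec_option_eq_iff: "(v :: 'a^('m::finite option)) = w \<longleftrightarrow> v $ None = w $ None \<and> (\<forall>k. v $ Some k = w $ Some k)"
  by (simp add: vec_eq_iff split_option_all)

lemma rest_join [simp]: "rest (join u x) = x"
  by (simp add: vec_eq_iff)

lemma join_rest [simp]: "join (q $ None) (rest q) = q"
  by (simp add: vec_option_eq_iff)

lemma bounded_linear_rest: "bounded_linear rest"
  by (intro linear_conv_bounded_linear[THEN iffD1] linearI) (simp_all add: vec_eq_iff)

lemma bounded_linear_join: "bounded_linear (\<lambda>p. join (fst p) (snd p))"
  by (intro linear_conv_bounded_linear[THEN iffD1] linearI) (simp_all add: vec_option_eq_iff)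

lemma axis_None: "axis None 1 = join 1 0"
  by (simp add: vec_option_eq_iff axis_def)

lemma axis_Some: "axis (Some k) 1 = join 0 (axis k 1)"
  by (simp add: vec_option_eq_iff axis_def)

lemma join_0_0 [simp]: "join 0 0 = 0"
  by (simp add: vec_option_eq_iff)

lemma has_vector_derivative_join:
  assumes "(F has_vector_derivative u) (at t)" "(x has_vector_derivative w) (at t)"
  shows "((\<lambda>t. join (F t) (x t)) has_vector_derivative join u w) (at t)"
  using bounded_linear.has_vector_derivative[OF bounded_linear_join has_vector_derivative_Pair[OF assms]]
  by simp

lemma rest_simps [simp]: "rest 0 = 0" "rest (axis None 1) = 0" "rest (axis (Some k) 1) = axis k 1"
  by (simp_all add: vec_eq_iff axis_None axis_Some)

text \<open>This embedding places a cyclic velocity, remaining positions and remaining velocities in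
  phase space at \<open>q $ None = 0\<close>; \<open>P\<close> below is defined through it.\<close>

lemma bounded_linear_phase_point:
  "bounded_linear (\<lambda>y :: real \<times> (real^'m) \<times> (real^'m). (join 0 (fst (snd y)), join (fst y) (snd (snd y))))"
  by (intro linear_conv_bounded_linear[THEN iffD1] linearI) (simp_all add: vec_option_eq_iff)

lemma smooth_join: "smooth a \<Longrightarrow> smooth b \<Longrightarrow> smooth (\<lambda>y. join (a y) (b y))"
  using smooth_compose[OF smooth_linear[OF bounded_linear_join] smooth_Pair] by force

lemma smooth_partial_vel: "smooth g \<Longrightarrow> smooth (partial_vel i g)"
  unfolding partial_vel_def by (rule smooth_dir_deriv)

lemma dir_deriv_eq_sum_partial:
  fixes g :: "real^'n::finite \<Rightarrow> real"
  assumes "smooth g"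
  shows "dir_deriv g d q = (\<Sum>i\<in>UNIV. d $ i * partial i g q)"
proof -
  have "dir_deriv g d q = dir_deriv g (\<Sum>i\<in>UNIV. d $ i *\<^sub>R axis i 1) q"
    using basis_expansion[of d] by (simp add: scalar_mult_eq_scaleR)
  then show ?thesis
    by (simp add: linear_sum[OF linear_dir_deriv[OF assms]]
        linear_scale[OF linear_dir_deriv[OF assms]] partial_def)
qed

lemma sum_UNIV_option: "(\<Sum>i\<in>(UNIV :: 'm::finite option set). h i) = h None + (\<Sum>k\<in>UNIV. h (Some k))"
  by (simp add: UNIV_option_conv sum.reindex)

section \<open>The Routhian\<close>

text \<open>\<open>solvable\<close> asks only for existence; uniqueness of the root follows from
  \<open>nondegenerate\<close>. \<open>degenerate\<close> supplies closedness in the one case,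
  constant \<open>f\<close>, where \<open>partial_f\<close> says nothing about
  \<open>\<Gamma>\<close>.\<close>

locale routh_system =
  fixes L :: "(real^('m::finite option)) \<times> (real^('m option)) \<Rightarrow> real"
    and f :: "real^('m option) \<Rightarrow> real"
    and \<Gamma> :: "'m \<Rightarrow> real^'m \<Rightarrow> real"
    and \<mu> :: real
  assumes L: "smooth L" and f: "smooth f" and \<Gamma>: "\<And>k. smooth (\<Gamma> k)"
    and quasi_cyclic: "quasi_cyclic None L f"
    and nondegenerate: "\<And>z. partial_vel None (partial_vel None L) z \<noteq> 0"
    and partial_f: "\<And>k q. partial (Some k) f q = \<Gamma> k (rest q) * partial None f q"
    and degenerate: "(\<forall>q q'. f q = f q') \<longrightarrow> closed_form \<Gamma>"
    and solvable: "\<And>q w. \<exists>u. partial_vel None L (q, join u w) = \<mu> + f q"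
begin

definition \<theta> :: "(real^('m option)) \<times> (real^('m option)) \<Rightarrow> real" where
  "\<theta> z = snd z $ None + (\<Sum>k\<in>UNIV. \<Gamma> k (rest (fst z)) * snd z $ Some k)"

definition M :: "(real^('m option)) \<times> (real^('m option)) \<Rightarrow> real" where
  "M z = L z - (\<mu> + f (fst z)) * \<theta> z"

lemma smooth_\<theta>: "smooth \<theta>"
  unfolding \<theta>_def
  by (intro smooth_add smooth_sum smooth_mult smooth_compose[OF \<Gamma>] smooth_linear
      bounded_linear_compose[OF bounded_linear_vec_nth bounded_linear_snd]
      bounded_linear_compose[OF bounded_linear_rest bounded_linear_fst])

lemma smooth_M: "smooth M"
  unfolding M_def
  by (intro smooth_diff smooth_mult smooth_add smooth_const smooth_\<theta> L
      smooth_compose[OF f] smooth_linear bounded_linear_fst)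

text \<open>By \<open>partial_f\<close> a common factor comes out of every term. In particular
  \<open>f\<close> is constant along curves whose velocity is annihilated by
  \<open>\<theta>\<close>.\<close>

lemma dir_deriv_f: "dir_deriv f d q = partial None f q * \<theta> (q, d)"
  by (simp add: dir_deriv_eq_sum_partial[OF f] sum_UNIV_option partial_f \<theta>_def
      algebra_simps sum_distrib_left)

lemma dir_deriv_\<Gamma>_rest: "dir_deriv (\<lambda>q. \<Gamma> k (rest q)) d q = dir_deriv (\<Gamma> k) (rest d) (rest q)"
  by (rule dir_deriv_linear_compose[OF \<Gamma> bounded_linear_rest])

lemma has_derivative_\<Gamma>_rest:
  "((\<lambda>q. \<Gamma> k (rest q)) has_derivative (\<lambda>d. dir_deriv (\<Gamma> k) (rest d) (rest q))) (at q)"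
  using smooth_has_derivative_dir_deriv[OF smooth_compose[OF \<Gamma> smooth_linear[OF bounded_linear_rest]]]
  by (simp add: dir_deriv_\<Gamma>_rest)

text \<open>As \<open>\<theta>\<close> is linear in the velocity, the variation \<open>e\<close>
  reproduces \<open>\<theta>\<close> and the variation \<open>d\<close> reaches only the
  coefficients.\<close>

lemma dir_deriv_\<theta>:
  "dir_deriv \<theta> (d, e) (q, v) = \<theta> (q, e) + (\<Sum>k\<in>UNIV. dir_deriv (\<Gamma> k) (rest d) (rest q) * v $ Some k)"
proof -
  note nth = bounded_linear.has_derivative[OF bounded_linear_vec_nth has_derivative_snd[OF has_derivative_ident]]
  have "(\<theta> has_derivative (\<lambda>h. snd h $ None + (\<Sum>k\<in>UNIV. \<Gamma> k (rest (fst (q, v))) * snd h $ Some k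
      + dir_deriv (\<Gamma> k) (rest (fst h)) (rest (fst (q, v))) * snd (q, v) $ Some k))) (at (q, v))"
    unfolding \<theta>_def[abs_def]
    by (intro has_derivative_add has_derivative_sum has_derivative_mult nth
        has_derivative_compose[OF has_derivative_fst[OF has_derivative_ident] has_derivative_\<Gamma>_rest])
  from dir_deriv_eqI[OF this] show ?thesis
    by (simp add: \<theta>_def sum.distrib)
qed

lemma dir_deriv_M:
  "dir_deriv M (d, e) (q, v) = dir_deriv L (d, e) (q, v) - dir_deriv f d q * \<theta> (q, v)
    - (\<mu> + f q) * (\<theta> (q, e) + (\<Sum>k\<in>UNIV. dir_deriv (\<Gamma> k) (rest d) (rest q) * v $ Some k))"
proof -
  have "((\<lambda>z. \<mu> + f (fst z)) has_derivative (\<lambda>h. 0 + dir_deriv f (fst h) (fst (q, v)))) (at (q, v))"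
    by (intro has_derivative_add has_derivative_const has_derivative_compose[OF
          has_derivative_fst[OF has_derivative_ident] smooth_has_derivative_dir_deriv[OF f]])
  from dir_deriv_eqI[OF has_derivative_diff[OF smooth_has_derivative_dir_deriv[OF L]
        has_derivative_mult[OF this smooth_has_derivative_dir_deriv[OF smooth_\<theta>]]], of "(d, e)"]
  show ?thesis
    by (simp add: M_def[abs_def] dir_deriv_\<theta> algebra_simps)
qed

lemma \<theta>_axis [simp]: "\<theta> (q, axis None 1) = 1" "\<theta> (q, axis (Some k) 1) = \<Gamma> k (rest q)" "\<theta> (q, 0) = 0"
  by (simp_all add: \<theta>_def axis_None axis_Some) (simp add: axis_def if_distrib sum.delta cong: if_cong)

lemma partial_pos_None_L: "partial_pos None L (q, v) = partial None f q * \<theta> (q, v)"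
  using quasi_cyclic dir_deriv_eq_sum_partial[OF f, of v q]
  by (simp add: quasi_cyclic_def dir_deriv_f)

text \<open>Quasi-cyclicity makes \<open>\<partial>L/\<partial>q\<^sub>1\<close> the derivative of
  \<open>f\<close> along \<open>v\<close>. It cancels against the variation of the factor
  \<open>\<mu> + f\<close>, and the coefficients of \<open>\<theta>\<close> do not contain
  \<open>q\<^sub>1\<close>.\<close>

lemma partial_pos_None_M: "dir_deriv M (axis None 1, 0) (q, v) = 0"
  using partial_pos_None_L[of q v] by (simp add: dir_deriv_M dir_deriv_f partial_pos_def)

lemma partial_vel_None_M: "partial_vel None M (q, v) = partial_vel None L (q, v) - (\<mu> + f q)"
  by (simp add: dir_deriv_M partial_vel_def)

lemma partial_vel_Some_M:
  "partial_vel (Some k) M (q, v) = partial_vel (Some k) L (q, v) - (\<mu> + f q) * \<Gamma> k (rest q)"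
  by (simp add: dir_deriv_M partial_vel_def)

section \<open>Independence of the cyclic coordinate\<close>

lemma M_cong:
  assumes "rest q = rest q'"
  shows "M (q, v) = M (q', v)"
proof -
  \<comment> \<open>Every position is compared with the representative at
    \<open>q $ None = 0\<close>, from which it is reached along the
    \<open>q\<^sub>1\<close>-axis.\<close>
  have "M (q, v) = M (join 0 (rest q), v)" for q
  proof -
    define \<phi> where "\<phi> s = M ((join 0 (rest q), v) + s *\<^sub>R (axis None 1, 0))" for s
    have "(\<phi> has_real_derivative 0) (at s)" for s
      using DERIV_smooth_along_line[OF smooth_M, of "(join 0 (rest q), v)" "(axis None 1, 0)" s]
      by (simp add: \<phi>_def[abs_def] partial_pos_None_M)
    then have "\<phi> (q $ None) = \<phi> 0" using DERIV_isconst_all by blast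
    moreover have "join 0 (rest q) + q $ None *\<^sub>R axis None 1 = q"
      by (simp add: vec_option_eq_iff axis_None)
    ultimately show ?thesis by (simp add: \<phi>_def)
  qed
  then show ?thesis using assms by metis
qed

lemma dir_deriv_M_cong:
  assumes "rest q = rest q'"
  shows "dir_deriv M (d, e) (q, v) = dir_deriv M (d, e) (q', v)"
proof -
  have "M (q + s *\<^sub>R d, v + s *\<^sub>R e) = M (q' + s *\<^sub>R d, v + s *\<^sub>R e)" for s
    using assms by (intro M_cong) (simp add: vec_eq_iff)
  then show ?thesis by (simp add: dir_deriv_def)
qed

section \<open>Closedness of \<open>\<Gamma>\<close>\<close>

lemma f_constant:
  assumes "\<And>a. partial None f (join a x) = 0"
  shows "f q = f (join 0 x)"
proof -
  define d where "d = rest q - x"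
  \<comment> \<open>A curve over the segment from \<open>x\<close> to \<open>rest q\<close> has its
    velocity in the kernel of \<open>\<theta>\<close> exactly when its first component has this
    derivative.\<close>
  have "continuous_on UNIV (\<lambda>t. - (\<Sum>k\<in>UNIV. \<Gamma> k (x + t *\<^sub>R d) * d $ k))"
    by (intro continuous_intros continuous_on_compose2[OF smooth_continuous_on[OF \<Gamma>, of UNIV]]) auto
  then obtain F where F: "(F has_real_derivative - (\<Sum>k\<in>UNIV. \<Gamma> k (x + t *\<^sub>R d) * d $ k)) (at t)" for t
    using antiderivative_on_open_interval[of UNIV] by auto
  \<comment> \<open>The constant is fixed so that \<open>c 1 = q\<close>. The other end
    \<open>c 0\<close> lies on the \<open>q\<^sub>1\<close>-line over \<open>x\<close>, along which
    \<open>f\<close> is constant by assumption.\<close>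
  define c where "c t = join (F t - F 1 + q $ None) (x + t *\<^sub>R d)" for t
  have c: "(c has_vector_derivative join (- (\<Sum>k\<in>UNIV. \<Gamma> k (x + t *\<^sub>R d) * d $ k)) d) (at t)" for t
    unfolding c_def using F[of t]
    by (intro has_vector_derivative_join)
      (auto intro!: derivative_eq_intros simp: has_real_derivative_iff_has_vector_derivative[symmetric]
        has_vector_derivative_def)
  have "((\<lambda>t. f (c t)) has_real_derivative 0) (at t)" for t
    using smooth_along_curve[OF f c[of t]] by (simp add: dir_deriv_f \<theta>_def c_def)
  then have "f (c 1) = f (c 0)"
    using DERIV_isconst_all[of "\<lambda>t. f (c t)"] by blast
  moreover have "c 1 = q" by (simp add: c_def d_def)
  moreover have "f (join a x) = f (join 0 x)" for a
  proof -
    have "((\<lambda>a. join a x) has_vector_derivative join 1 0) (at a)" for a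
      by (intro has_vector_derivative_join) (auto intro!: derivative_eq_intros)
    from smooth_along_curve[OF f this] have "((\<lambda>a. f (join a x)) has_real_derivative 0) (at a)" for a
      by (simp add: dir_deriv_f assms)
    then show ?thesis using DERIV_isconst_all[of "\<lambda>a. f (join a x)"] by blast
  qed
  ultimately show ?thesis by (metis c_def add.right_neutral scaleR_zero_left)
qed

lemma closed_form_\<Gamma>: "closed_form \<Gamma>"
proof (cases "\<exists>x. \<forall>a. partial None f (join a x) = 0")
  case True
  then have "\<forall>q q'. f q = f q'" using f_constant by metis
  then show ?thesis using degenerate by blast
next
  case False
  show ?thesis unfolding closed_form_def
  proof (intro allI)
    fix k l x
    \<comment> \<open>\<open>\<Gamma>\<close> is evaluated at \<open>x\<close> only, so the height
      \<open>a\<close> above it may be chosen freely.\<close>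
    obtain a where nz: "partial None f (join a x) \<noteq> 0" using False by blast
    define q where "q = join a x"
    define f1 where "f1 = partial None f"
    have f1: "smooth f1" unfolding f1_def partial_def by (rule smooth_dir_deriv[OF f])
    have fk: "partial (Some k) f = (\<lambda>q. \<Gamma> k (rest q) * f1 q)" for k
      by (simp add: fun_eq_iff partial_f f1_def)
    have D: "dir_deriv (partial (Some k) f) d q
        = \<Gamma> k x * dir_deriv f1 d q + dir_deriv (\<Gamma> k) (rest d) x * f1 q" for k d
      using dir_deriv_eqI[OF has_derivative_mult[OF has_derivative_\<Gamma>_rest[of k q] smooth_has_derivative_dir_deriv[OF f1]], of d]
      by (simp add: fk q_def)
    have "dir_deriv (partial (Some k) f) (axis (Some l) 1) q
        = \<Gamma> k x * (\<Gamma> l x * dir_deriv f1 (axis None 1) q) + partial l (\<Gamma> k) x * f1 q" for k l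
    proof -
      \<comment> \<open>After the exchange the derivative runs along \<open>q\<^sub>1\<close>, which
        leaves \<open>\<Gamma> l\<close> untouched. The first summand becomes symmetric in
        \<open>k\<close> and \<open>l\<close> and drops out of the comparison below.\<close>
      have "dir_deriv f1 (axis (Some l) 1) q = dir_deriv (partial (Some l) f) (axis None 1) q"
        unfolding f1_def partial_def by (rule dir_deriv_commute[OF f])
      then show ?thesis by (simp add: D) (simp add: partial_def)
    qed
    moreover have "dir_deriv (partial (Some k) f) (axis (Some l) 1) q
        = dir_deriv (partial (Some l) f) (axis (Some k) 1) q"
      unfolding partial_def by (rule dir_deriv_commute[OF f])
    ultimately have "partial l (\<Gamma> k) x * f1 q = partial k (\<Gamma> l) x * f1 q"
      by (simp add: mult.left_commute)
    then show "partial l (\<Gamma> k) x = partial k (\<Gamma> l) x"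
      using nz by (simp add: f1_def q_def)
  qed
qed

text \<open>Closedness replaces the sum of the terms
  \<open>\<partial>\<^sub>k \<Gamma>\<^sub>l v\<^sub>l\<close> over \<open>l\<close> by the
  derivative of \<open>\<Gamma> k\<close> along the velocity, which gives the correction the shape
  of a product rule.\<close>

lemma partial_pos_Some_M:
  "partial_pos (Some k) M (q, v) = partial_pos (Some k) L (q, v)
    - (partial None f q * \<theta> (q, v) * \<Gamma> k (rest q) + (\<mu> + f q) * dir_deriv (\<Gamma> k) (rest v) (rest q))"
proof -
  have "dir_deriv (\<Gamma> k) (rest v) (rest q) = (\<Sum>l\<in>UNIV. partial k (\<Gamma> l) (rest q) * v $ Some l)"
    using closed_form_\<Gamma> by (simp add: dir_deriv_eq_sum_partial[OF \<Gamma>] closed_form_def mult.commute)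
  then show ?thesis
    by (simp add: partial_pos_def dir_deriv_M dir_deriv_f partial_def[of _ "\<Gamma> _"] mult_ac)
qed

text \<open>Since \<open>L - M = (\<mu> + f) \<theta>\<close>, this is the Euler-Lagrange equation
  of \<open>(\<mu> + f) \<theta>\<close> for the coordinate \<open>Some k\<close>; it holds along
  every differentiable curve.\<close>

lemma gyroscopic_along_curve:
  assumes "(q has_vector_derivative v) (at t)"
  shows "((\<lambda>t. (\<mu> + f (q t)) * \<Gamma> k (rest (q t))) has_real_derivative
    partial_pos (Some k) L (q t, v) - partial_pos (Some k) M (q t, v)) (at t)"
proof -
  have "((\<lambda>t. \<Gamma> k (rest (q t))) has_real_derivative dir_deriv (\<Gamma> k) (rest v) (rest (q t))) (at t)"
    by (rule smooth_along_curve[OF \<Gamma> bounded_linear.has_vector_derivative[OF bounded_linear_rest assms]])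
  from DERIV_mult[OF DERIV_add[OF DERIV_const smooth_along_curve[OF f assms]] this]
  show ?thesis by (simp add: partial_pos_Some_M dir_deriv_f algebra_simps)
qed

section \<open>Elimination of the cyclic velocity\<close>

definition P :: "real \<times> (real^'m) \<times> (real^'m) \<Rightarrow> real" where
  "P y = partial_vel None M (join 0 (fst (snd y)), join (fst y) (snd (snd y)))"

lemma smooth_P: "smooth P"
  unfolding P_def[abs_def]
  by (intro smooth_compose[OF smooth_partial_vel[OF smooth_M]] smooth_linear bounded_linear_phase_point)

text \<open>The two momenta differ by \<open>\<mu> + f\<close>, which is constant in the velocity;
  nondegeneracy thus passes from \<open>L\<close> to \<open>M\<close>.\<close>

lemma partial_vel_partial_vel_None_M:
  "partial_vel None (partial_vel None M) (q, v) = partial_vel None (partial_vel None L) (q, v)"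
proof -
  have "((\<lambda>s. partial_vel None L ((q, v) + s *\<^sub>R (0, axis None 1)) - (\<mu> + f q))
      has_real_derivative partial_vel None (partial_vel None L) ((q, v) + 0 *\<^sub>R (0, axis None 1)) - 0) (at 0)"
    unfolding partial_vel_def[of _ "partial_vel None L"]
    by (intro DERIV_diff DERIV_const DERIV_smooth_along_line smooth_partial_vel L)
  from DERIV_imp_deriv[OF this] show ?thesis
    by (simp add: partial_vel_def[of _ "partial_vel None M"] dir_deriv_def partial_vel_None_M)
qed

lemma P_nondegenerate: "dir_deriv P (1, 0) y \<noteq> 0"
proof -
  have "dir_deriv P (1, 0) y = dir_deriv (partial_vel None M) (0, axis None 1)
      (join 0 (fst (snd y)), join (fst y) (snd (snd y)))" (is "_ = dir_deriv _ _ ?z")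
    unfolding P_def[abs_def]
    by (subst dir_deriv_linear_compose[OF smooth_partial_vel[OF smooth_M] bounded_linear_phase_point])
      (simp add: axis_None)
  also have "\<dots> = partial_vel None (partial_vel None L) ?z"
    using partial_vel_partial_vel_None_M unfolding partial_vel_def[of _ "partial_vel None M"] .
  finally show ?thesis using nondegenerate by simp
qed

text \<open>\<open>P\<close> fixes the position at \<open>q $ None = 0\<close>, and independence of
  \<open>M\<close> from that coordinate transports the equation to every \<open>q\<close>. The roots
  are therefore the same along each \<open>q\<^sub>1\<close>-line.\<close>

lemma P_eq_0_iff:
  "P (u, rest q, w) = 0 \<longleftrightarrow> partial_vel None L (q, join u w) = \<mu> + f q"
  using dir_deriv_M_cong[of "join 0 (rest q)" q 0 "axis None 1" "join u w"] partial_vel_None_M[of q "join u w"]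
  by (simp add: P_def partial_vel_def)

text \<open>An arbitrary root is picked; \<open>eq_U_iff\<close> shows that there is only
  one.\<close>

definition U :: "(real^'m) \<times> (real^'m) \<Rightarrow> real" where
  "U y = (SOME u. P (u, y) = 0)"

lemma P_U: "P (U y, y) = 0"
proof -
  obtain u where "partial_vel None L (join 0 (fst y), join u (snd y)) = \<mu> + f (join 0 (fst y))"
    using solvable by blast
  then have "P (u, y) = 0" using P_eq_0_iff[of u "join 0 (fst y)" "snd y"] by simp
  then show ?thesis unfolding U_def by (rule someI)
qed

lemma eq_U_iff: "u = U (rest q, w) \<longleftrightarrow> partial_vel None L (q, join u w) = \<mu> + f q"
  using P_eq_0_iff P_U inj_in_fst[OF smooth_P P_nondegenerate] by metis

lemma smooth_U: "smooth U"
  by (rule implicit_function_smooth[OF smooth_P P_nondegenerate P_U])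

text \<open>The momentum level set is the graph of \<open>U\<close>; both projection and lifting use
  the momentum condition in this form.\<close>

lemma momentum_iff: "partial_vel None L (q, v) - f q = \<mu> \<longleftrightarrow> v $ None = U (rest q, rest v)"
  by (simp add: eq_U_iff algebra_simps)

text \<open>The value 0 of the cyclic coordinate is a convention: by \<open>M_cong\<close> any other
  value gives the same function.\<close>

definition R :: "(real^'m) \<times> (real^'m) \<Rightarrow> real" where
  "R y = M (join 0 (fst y), join (U y) (snd y))"

lemma routhian_eq_R: "routhian L f \<Gamma> \<mu> q w = R (rest q, w)"
proof -
  have "cyclic_velocity L f \<mu> q w = U (rest q, w)"
    unfolding cyclic_velocity_def by (simp flip: eq_U_iff)
  then have "routhian L f \<Gamma> \<mu> q w = M (q, join (U (rest q, w)) w)"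
    by (simp add: routhian_def M_def \<theta>_def Let_def)
  then show ?thesis using M_cong[of q "join 0 (rest q)"] by (simp add: R_def)
qed

lemma smooth_R: "smooth R"
  unfolding R_def[abs_def]
  by (intro smooth_compose[OF smooth_M] smooth_Pair smooth_join smooth_U smooth_const
      smooth_linear bounded_linear_fst bounded_linear_snd)

text \<open>By the momentum equation the variation of the eliminated velocity does not contribute.\<close>

lemma dir_deriv_R:
  assumes "v $ None = U (rest q, rest v)"
  shows "dir_deriv R (h, k) (rest q, rest v) = dir_deriv M (join 0 h, join 0 k) (q, v)"
proof -
  let ?y = "(rest q, rest v)" and ?z = "(join 0 (rest q), v)"
  have "bounded_linear (join 0 :: real^'m \<Rightarrow> _)"
    using bounded_linear_compose[OF bounded_linear_join bounded_linear_Pair[OF bounded_linear_zero bounded_linear_ident]]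
    by simp
  note J0 = bounded_linear.has_derivative[OF this has_derivative_fst[OF has_derivative_ident]]
  note JU = bounded_linear.has_derivative[OF bounded_linear_join has_derivative_Pair[OF
        smooth_has_derivative_dir_deriv[OF smooth_U] has_derivative_snd[OF has_derivative_ident]]]
  have v: "join (U ?y) (rest v) = v" by (simp flip: assms)
  have "dir_deriv R (h, k) ?y = dir_deriv M (join 0 h, join (dir_deriv U (h, k) ?y) k) ?z"
    using dir_deriv_eqI[OF has_derivative_compose[OF has_derivative_Pair[OF J0 JU]
          smooth_has_derivative_dir_deriv[OF smooth_M]], of "(h, k)" ?y]
    by (simp add: R_def[abs_def] v)
  also have "(join 0 h, join (dir_deriv U (h, k) ?y) k)
      = (join 0 h, join 0 k) + dir_deriv U (h, k) ?y *\<^sub>R (0, axis None 1)"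
    by (simp add: vec_option_eq_iff axis_None)
  also have "dir_deriv M \<dots> ?z = dir_deriv M (join 0 h, join 0 k) ?z
      + dir_deriv U (h, k) ?y * partial_vel None M ?z"
    unfolding linear_add[OF linear_dir_deriv[OF smooth_M]] linear_scale[OF linear_dir_deriv[OF smooth_M]]
    by (simp add: partial_vel_def)
  also have "partial_vel None M ?z = 0"
    using P_U[of ?y] by (simp add: P_def v)
  finally show ?thesis
    using dir_deriv_M_cong[of "join 0 (rest q)" q] by simp
qed

lemma partial_R:
  assumes "v $ None = U (rest q, rest v)"
  shows "partial_pos k R (rest q, rest v) = partial_pos (Some k) M (q, v)"
    and "partial_vel k R (rest q, rest v) = partial_vel (Some k) M (q, v)"
  by (simp_all add: partial_pos_def partial_vel_def dir_deriv_R[OF assms] axis_Some)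

section \<open>Comparison of the Euler-Lagrange equations\<close>

lemma EL_equation_iff:
  assumes "open I" "t \<in> I"
    and q: "\<And>s. s \<in> I \<Longrightarrow> (q has_vector_derivative v s) (at s)"
    and U: "\<And>s. s \<in> I \<Longrightarrow> v s $ None = U (rest (q s), rest (v s))"
  shows "((\<lambda>s. partial_vel k R (rest (q s), rest (v s))) has_real_derivative
      partial_pos k R (rest (q t), rest (v t))) (at t) \<longleftrightarrow>
    ((\<lambda>s. partial_vel (Some k) L (q s, v s)) has_real_derivative
      partial_pos (Some k) L (q t, v t)) (at t)" (is "?R \<longleftrightarrow> ?L")
proof
  note G = gyroscopic_along_curve[OF q[OF \<open>t \<in> I\<close>], of k]
  assume ?R
  \<comment> \<open>By \<open>partial_R\<close> the derivatives of \<open>R\<close> are those of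
    \<open>M\<close> along the curve, and adding the identity \<open>G\<close> turns both sides into
    those of \<open>L\<close>.\<close>
  have "((\<lambda>s. partial_vel k R (rest (q s), rest (v s)) + (\<mu> + f (q s)) * \<Gamma> k (rest (q s)))
      has_real_derivative partial_pos (Some k) L (q t, v t)) (at t)"
    using DERIV_add[OF \<open>?R\<close> G] by (simp add: partial_R(1)[OF U[OF \<open>t \<in> I\<close>]])
  \<comment> \<open>The momenta are compared by means of \<open>U\<close> at all times in
    \<open>I\<close>; openness of \<open>I\<close> makes this enough for the derivative at
    \<open>t\<close>.\<close>
  then show ?L
    by (rule has_field_derivative_transform_within_open[OF _ assms(1,2)])
      (simp add: partial_R(2)[OF U] partial_vel_Some_M)
next
  note G = gyroscopic_along_curve[OF q[OF \<open>t \<in> I\<close>], of k]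
  assume ?L
  have "((\<lambda>s. partial_vel (Some k) L (q s, v s) - (\<mu> + f (q s)) * \<Gamma> k (rest (q s)))
      has_real_derivative partial_pos k R (rest (q t), rest (v t))) (at t)"
    using DERIV_diff[OF \<open>?L\<close> G] by (simp add: partial_R(1)[OF U[OF \<open>t \<in> I\<close>]])
  then show ?R
    by (rule has_field_derivative_transform_within_open[OF _ assms(1,2)])
      (simp add: partial_R(2)[OF U] partial_vel_Some_M)
qed

lemma EL_solution_projects:
  assumes "open I" and EL: "EL_solution L I q"
    and mom: "\<And>t. t \<in> I \<Longrightarrow> partial_vel None L (q t, velocity q t) - f (q t) = \<mu>"
  shows "EL_solution R I (\<lambda>t. rest (q t))"
proof -
  have q: "q C1_differentiable_on I" and v: "velocity q C1_differentiable_on I"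
    using EL by (auto simp: EL_solution_def)
  note q' = C1_differentiable_on_has_velocity[OF q]
  have vel: "velocity (\<lambda>t. rest (q t)) t = rest (velocity q t)" if "t \<in> I" for t
    by (rule vector_derivative_at[OF bounded_linear.has_vector_derivative[OF bounded_linear_rest q'[OF that]]])
  have U: "velocity q t $ None = U (rest (q t), rest (velocity q t))" if "t \<in> I" for t
    using mom[OF that] by (simp add: momentum_iff)
  show ?thesis unfolding EL_solution_def
  proof (intro conjI allI ballI)
    show "(\<lambda>t. rest (q t)) C1_differentiable_on I"
      by (rule C1_differentiable_on_smooth_compose[OF smooth_linear[OF bounded_linear_rest] q])
    show "velocity (\<lambda>t. rest (q t)) C1_differentiable_on I"
      using C1_differentiable_on_smooth_compose[OF smooth_linear[OF bounded_linear_rest] v]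
        C1_differentiable_on_cong_open[OF \<open>open I\<close> vel] by simp
    fix k t assume t: "t \<in> I"
    have "((\<lambda>s. partial_vel (Some k) L (q s, velocity q s)) has_real_derivative
        partial_pos (Some k) L (q t, velocity q t)) (at t)"
      using EL t by (auto simp: EL_solution_def)
    then have "((\<lambda>s. partial_vel k R (rest (q s), rest (velocity q s))) has_real_derivative
        partial_pos k R (rest (q t), rest (velocity q t))) (at t)"
      using EL_equation_iff[OF \<open>open I\<close> t q' U] by simp
    \<comment> \<open>The velocity of the projected curve is known to be the projected velocity on
      \<open>I\<close>, which is a neighbourhood of \<open>t\<close>.\<close>
    then have "((\<lambda>s. partial_vel k R (rest (q s), velocity (\<lambda>t. rest (q t)) s)) has_real_derivative
        partial_pos k R (rest (q t), rest (velocity q t))) (at t)"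
      by (rule has_field_derivative_transform_within_open[OF _ \<open>open I\<close> t]) (simp add: vel)
    then show "((\<lambda>s. partial_vel k R (rest (q s), velocity (\<lambda>t. rest (q t)) s)) has_real_derivative
        partial_pos k R (rest (q t), velocity (\<lambda>t. rest (q t)) t)) (at t)"
      by (simp add: vel[OF t])
  qed
qed

lemma EL_solution_lifts:
  assumes "open I" "is_interval I" and EL: "EL_solution R I x"
  shows "\<exists>q. EL_solution L I q \<and> (\<forall>t\<in>I. rest (q t) = x t) \<and>
    (\<forall>t\<in>I. partial_vel None L (q t, velocity q t) - f (q t) = \<mu>)"
proof -
  have x: "x C1_differentiable_on I" and w: "velocity x C1_differentiable_on I"
    using EL by (auto simp: EL_solution_def)
  \<comment> \<open>The full velocity is determined by \<open>x\<close> alone because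
    \<open>U\<close> does not involve \<open>q\<^sub>1\<close>. It is prescribed first, and
    integrating its cyclic component then gives the curve.\<close>
  define v where "v t = join (U (x t, velocity x t)) (velocity x t)" for t
  have v: "v C1_differentiable_on I"
    unfolding v_def
    using C1_differentiable_on_smooth_compose[OF smooth_join[OF smooth_U smooth_linear[OF bounded_linear_snd]]
        C1_differentiable_on_Pair[OF x w]] by simp
  have "continuous_on I (\<lambda>t. U (x t, velocity x t))"
    using C1_differentiable_imp_continuous_on[OF x] C1_differentiable_imp_continuous_on[OF w]
    by (intro continuous_on_compose2[OF smooth_continuous_on[OF smooth_U, of UNIV]] continuous_on_Pair) auto
  then obtain F where F: "\<And>t. t \<in> I \<Longrightarrow> (F has_real_derivative U (x t, velocity x t)) (at t)"
    using antiderivative_on_open_interval[OF assms(1,2)] by blast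
  define q where "q t = join (F t) (x t)" for t
  have q': "(q has_vector_derivative v t) (at t)" if "t \<in> I" for t
    unfolding q_def v_def
    using F[OF that] C1_differentiable_on_has_velocity[OF x that]
    by (intro has_vector_derivative_join) (simp_all add: has_real_derivative_iff_has_vector_derivative)
  have vel: "velocity q t = v t" if "t \<in> I" for t
    by (rule vector_derivative_at[OF q'[OF that]])
  have rest_q [simp]: "rest (q t) = x t" and rest_v [simp]: "rest (v t) = velocity x t" for t
    by (simp_all add: q_def v_def)
  have U: "v t $ None = U (rest (q t), rest (v t))" for t
    by (simp add: v_def)
  have mom: "partial_vel None L (q t, v t) - f (q t) = \<mu>" for t
    using U by (simp add: momentum_iff)
  have EL_v: "((\<lambda>s. partial_vel i L (q s, v s)) has_real_derivative partial_pos i L (q t, v t)) (at t)"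
    if t: "t \<in> I" for i t
  proof (cases i)
    case None
    \<comment> \<open>The equation for \<open>q\<^sub>1\<close> is the time derivative of this
      constraint: \<open>\<mu> + f\<close> changes at the rate of \<open>f\<close> along
      \<open>v\<close>, which by quasi-cyclicity is
      \<open>\<partial>L/\<partial>q\<^sub>1\<close>.\<close>
    have "partial_vel None L (q s, v s) = \<mu> + f (q s)" for s
      using mom[of s] by simp
    then show ?thesis
      using DERIV_add[OF DERIV_const smooth_along_curve[OF f q'[OF t]], of \<mu>]
      by (simp add: None partial_pos_None_L dir_deriv_f)
  next
    case (Some k)
    have "((\<lambda>s. partial_vel k R (x s, velocity x s)) has_real_derivative
        partial_pos k R (x t, velocity x t)) (at t)"
      using EL t by (auto simp: EL_solution_def)
    then show ?thesis
      using EL_equation_iff[OF \<open>open I\<close> t q' U] Some by simp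
  qed
  have "EL_solution L I q" unfolding EL_solution_def
  proof (intro conjI allI ballI)
    show "q C1_differentiable_on I"
      unfolding C1_differentiable_on_def
      using q' C1_differentiable_imp_continuous_on[OF v] by blast
    show "velocity q C1_differentiable_on I"
      using v C1_differentiable_on_cong_open[OF \<open>open I\<close> vel] by simp
    fix i t assume t: "t \<in> I"
    show "((\<lambda>s. partial_vel i L (q s, velocity q s)) has_real_derivative
        partial_pos i L (q t, velocity q t)) (at t)"
      unfolding vel[OF t]
      by (rule has_field_derivative_transform_within_open[OF EL_v[OF t] \<open>open I\<close> t]) (simp add: vel)
  qed
  then show ?thesis using mom vel by (intro exI[of _ q]) simp
qed

end

theorem theorem2:
  fixes L :: "(real^('m::finite option)) \<times> (real^('m option)) \<Rightarrow> real"
    and f :: "real^('m option) \<Rightarrow> real"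
    and \<Gamma> :: "'m \<Rightarrow> real^'m \<Rightarrow> real"
    and \<mu> :: real
  assumes "smooth L" and "smooth f" and "\<And>k. smooth (\<Gamma> k)"
    and "regular_lagrangian L"
    and "quasi_cyclic None L f"
    and "\<And>z. partial_vel None (partial_vel None L) z \<noteq> 0"
    and "\<And>k q. partial (Some k) f q = \<Gamma> k (rest q) * partial None f q"
    and degenerate: "(\<forall>q q'. f q = f q') \<longrightarrow> closed_form \<Gamma>"
    and solvable: "\<And>q w. \<exists>u. partial_vel None L (q, join u w) = \<mu> + f q"
  shows "\<exists>R :: (real^'m) \<times> (real^'m) \<Rightarrow> real.
      smooth R \<and> (\<forall>q w. routhian L f \<Gamma> \<mu> q w = R (rest q, w)) \<and>
      (\<forall>I q. open I \<and> is_interval I \<and> EL_solution L I q \<and>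
          (\<forall>t\<in>I. partial_vel None L (q t, velocity q t) - f (q t) = \<mu>)
        \<longrightarrow> EL_solution R I (\<lambda>t. rest (q t))) \<and>
      (\<forall>I x. open I \<and> is_interval I \<and> EL_solution R I x
        \<longrightarrow> (\<exists>q. EL_solution L I q \<and> (\<forall>t\<in>I. rest (q t) = x t) \<and>
              (\<forall>t\<in>I. partial_vel None L (q t, velocity q t) - f (q t) = \<mu>)))"
proof -
  interpret routh_system L f \<Gamma> \<mu>
    using assms by unfold_locales
  show ?thesis
  proof (intro exI[of _ R] conjI allI impI)
    show "smooth R" by (rule smooth_R)
    show "routhian L f \<Gamma> \<mu> q w = R (rest q, w)" for q w by (rule routhian_eq_R)
  qed (simp add: EL_solution_projects, elim conjE, rule EL_solution_lifts)
qed

end
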